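(* Let $\mathcal{G}$ be a tree graph with $n$ vertices and let $Y=f^0+\epsilon$ with $f^0\in\mathbb{R}^n$ and $\epsilon\sim\mathcal{N}_n(0,\sigma^2 I_n)$. Let $S\subseteq\{2,\ldots,n\}$ with $s:=|S|$. Fix $\delta\in(0,1)$ and $\gamma>1$, and choose $\lambda=\gamma\sigma\sqrt{2\log\left(4(n-s-1)/\delta\right)/n}$. Let $\widehat f:=\arg\min_{f\in\mathbb{R}^n}\{\|Y-f\|_n^2+2\lambda\|Df\|_1\}$. Then, with probability at least $1-\delta$, $$\|\widehat f-f^0\|_n^2\le \inf_{f\in\mathbb{R}^n}\left\{\|f-f^0\|_n^2+4\lambda\|(Df)_{-S}\|_1\right\}+\frac{4\sigma^2}{n}\left((s+1)+2\log(2/\delta)+\frac{\gamma^2(s+1)}{\kappa_w^2(S)}\log\left(4(n-s-1)/\delta\right)\right),$$ where $\kappa_w(S)$ is the weighted compatibility constant associated with $\mathcal{G}$, $S$ and $\gamma$.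
   Context: For $v\in\mathbb{R}^n$, $\|v\|_1=\sum_i|v_i|$, $\|v\|_2^2=\sum_i v_i^2$, $\|v\|_n^2=\frac1n\sum_i v_i^2$. Tree and incidence matrix. The tree has vertices $1,\ldots,n$, is rooted at vertex $1$, and is labelled so that each vertex $i\ge2$ has a parent $\mathrm{pa}(i)<i$ (its neighbour on the path to the root). Edges are indexed by their child vertex $i\in\{2,\ldots,n\}$. The incidence matrix $D\in\mathbb{R}^{(n-1)\times n}$ has rows indexed by $i\in\{2,\dots,n\}$ with $(Df)_i=f_i-f_{\mathrm{pa}(i)}$. For $S\subseteq\{2,\ldots,n\}$, $(Df)_{-S}$ is the subvector of $Df$ with indices in $\{2,\ldots,n\}\setminus S$. The rooted incidence matrix $\widetilde D\in\mathbb{R}^{n\times n}$ has first row $(1,0,\ldots,0)$ followed by the rows of $D$; $X:=\widetilde D^{-1}$ is the path matrix: $X_{ij}=1$ if $j$ lies on the path from vertex $1$ to vertex $i$ (endpoints included), and $X_{ij}=0$ otherwise. $X_j$ is the $j$-th column of $X$ and $X_{T}$ the submatrix of columns in $T$. Weights. $\Pi_{\{1\}\cup S}$ is the orthogonal projection onto the column span of $X_{\{1\}\cup S}$. Set $\omega_j=\|X_j'(I_n-\Pi_{\{1\}\cup S})\|_2/\sqrt n$ and $w_j=1-\omega_j/\gamma$ for $j=1,\ldots,n$. Weighted compatibility constant: $$\kappa_w^2(S):=\min\left\{(s+1)\|X\beta\|_n^2:\ \beta\in\mathbb{R}^n,\ \|(w\odot\beta)_S\|_1-\|(w\odot\beta)_{-(\{1\}\cup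 S)}\|_1=1\right\},$$ where $\odot$ is the entrywise product, and subscripts $S$ and $-(\{1\}\cup S)$ denote restriction to indices in $S$ and in $\{1,\ldots,n\}\setminus(\{1\}\cup S)$. *)

theory Defs
  imports "HOL-Probability.Probability"
begin

text \<open>
  The index type \<open>'n\<close> is a finite linear order, i.e. \<open>{1, \<dots>, n}\<close> with \<open>n = CARD('n)\<close>; vertex 1 is
  its least element.  A rooted tree labelled so that every non-root vertex has a smaller parent is
  given by its parent function; edges are indexed by their child vertex, so the index set
  \<open>{2, \<dots>, n}\<close> of the edges is \<open>- {tree_root}\<close>.
\<close>

definition tree_root :: "'n::{finite,linorder}" where
  "tree_root = Min UNIV"

text \<open>The value of \<open>pa\<close> at the root is irrelevant.\<close>

definition parent_function :: "('n::{finite,linorder} \<Rightarrow> 'n) \<Rightarrow> bool" where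
  "parent_function pa \<longleftrightarrow> (\<forall>i. i \<noteq> tree_root \<longrightarrow> pa i < i)"

definition incidence_row :: "('n::{finite,linorder} \<Rightarrow> 'n) \<Rightarrow> 'n \<Rightarrow> real^('n::{finite,linorder})" where
  "incidence_row pa i = axis i 1 - axis (pa i) 1"

text \<open>
  \<open>edge_diff pa f i\<close> is the entry of \<open>D f\<close> at the edge \<open>i\<close>; it is only used for \<open>i \<noteq> tree_root\<close>.
\<close>

definition edge_diff :: "('n::{finite,linorder} \<Rightarrow> 'n) \<Rightarrow> real^('n::{finite,linorder}) \<Rightarrow> 'n \<Rightarrow> real" where
  "edge_diff pa f i = incidence_row pa i \<bullet> f"

lemma edge_diff_eq: "edge_diff pa f i = f $ i - f $ pa i"
  by (simp add: edge_diff_def incidence_row_def inner_diff_left inner_axis')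

definition rooted_incidence :: "('n::{finite,linorder} \<Rightarrow> 'n) \<Rightarrow> real^('n::{finite,linorder})^('n::{finite,linorder})" where
  "rooted_incidence pa = (\<chi> i. if i = tree_root then axis i 1 else incidence_row pa i)"

definition path_matrix :: "('n::{finite,linorder} \<Rightarrow> 'n) \<Rightarrow> real^('n::{finite,linorder})^('n::{finite,linorder})" where
  "path_matrix pa = matrix_inv (rooted_incidence pa)"

definition to_root :: "('n::{finite,linorder} \<Rightarrow> 'n) \<Rightarrow> ('n \<times> 'n) set" where
  "to_root pa = {(i, pa i) |i. i \<noteq> tree_root}"

lemma rooted_incidence_path:
  fixes pa :: "'n::{finite,linorder} \<Rightarrow> 'n"
  assumes pa: "parent_function pa"
  shows "rooted_incidence pa ** (\<chi> i j. of_bool ((i, j) \<in> (to_root pa)\<^sup>*)) = mat 1"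
proof -
  let ?P = "(\<chi> i j. of_bool ((i, j) \<in> (to_root pa)\<^sup>*)) :: real^('n::{finite,linorder})^('n::{finite,linorder})"
  have le: "j \<le> i" if "(i, j) \<in> (to_root pa)\<^sup>*" for i j
    using that
  proof (induction rule: rtrancl_induct)
    case (step y z)
    then have "z < y" using pa by (auto simp: to_root_def parent_function_def)
    with step show ?case by simp
  qed simp
  have eq: "(i, j) \<in> (to_root pa)\<^sup>* \<longleftrightarrow> i = j \<or> (i \<noteq> tree_root \<and> (pa i, j) \<in> (to_root pa)\<^sup>*)" for i j
  proof
    assume "(i, j) \<in> (to_root pa)\<^sup>*"
    then show "i = j \<or> (i \<noteq> tree_root \<and> (pa i, j) \<in> (to_root pa)\<^sup>*)"
      by (cases rule: converse_rtranclE) (auto simp: to_root_def)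
  next
    assume "i = j \<or> (i \<noteq> tree_root \<and> (pa i, j) \<in> (to_root pa)\<^sup>*)"
    moreover have "(i, pa i) \<in> to_root pa" if "i \<noteq> tree_root"
      using that by (auto simp: to_root_def)
    ultimately show "(i, j) \<in> (to_root pa)\<^sup>*"
      by (auto intro: converse_rtrancl_into_rtrancl)
  qed
  have entry: "(rooted_incidence pa ** ?P) $ i $ j = rooted_incidence pa $ i \<bullet> (\<chi> k. ?P $ k $ j)" for i j
    by (simp add: matrix_matrix_mult_def inner_vec_def)
  have "(rooted_incidence pa ** ?P) $ i $ j = mat 1 $ i $ j" for i j
  proof (cases "i = tree_root")
    case True
    then show ?thesis
      unfolding entry using eq[of i j]
      by (simp add: rooted_incidence_def inner_axis' mat_def)
  next
    case False
    then have "pa i < i" using pa by (simp add: parent_function_def)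
    then have "(pa i, i) \<notin> (to_root pa)\<^sup>*" using le by fastforce
    then show ?thesis
      unfolding entry using eq[of i j] False
      by (auto simp: rooted_incidence_def incidence_row_def inner_diff_left inner_axis' mat_def)
  qed
  then show ?thesis by (simp add: vec_eq_iff)
qed

text \<open>
  Entry \<open>(i, j)\<close> of the path matrix is 1 if \<open>j\<close> lies on the path from the root to \<open>i\<close>, and 0 otherwise.
\<close>

lemma path_matrix_nth:
  fixes pa :: "'n::{finite,linorder} \<Rightarrow> 'n"
  assumes "parent_function pa"
  shows "path_matrix pa $ i $ j = of_bool ((i, j) \<in> (to_root pa)\<^sup>*)"
proof -
  let ?P = "(\<chi> i j. of_bool ((i, j) \<in> (to_root pa)\<^sup>*)) :: real^('n::{finite,linorder})^('n::{finite,linorder})"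
  have 1: "rooted_incidence pa ** ?P = mat 1"
    by (rule rooted_incidence_path[OF assms])
  then have "\<exists>B. rooted_incidence pa ** B = mat 1 \<and> B ** rooted_incidence pa = mat 1"
    using matrix_left_right_inverse by blast
  then have "path_matrix pa ** rooted_incidence pa = mat 1"
    unfolding path_matrix_def matrix_inv_def by (rule someI2_ex) simp
  with 1 have "path_matrix pa = path_matrix pa ** (rooted_incidence pa ** ?P)
      \<and> path_matrix pa ** rooted_incidence pa = mat 1"
    by simp
  then have "path_matrix pa = ?P"
    by (metis matrix_mul_assoc matrix_mul_lid)
  then show ?thesis by simp
qed

text \<open>The squared norm \<open>\<parallel>v\<parallel>\<^sub>n\<^sup>2\<close>.\<close>

definition sqnorm_n :: "real^'n \<Rightarrow> real" where
  "sqnorm_n v = (\<Sum>i\<in>UNIV. (v $ i)\<^sup>2) / real CARD('n)"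

text \<open>The matrix of the orthogonal projection onto the span of \<open>B\<close>.\<close>

definition proj_matrix :: "(real^'n) set \<Rightarrow> real^'n^'n" where
  "proj_matrix B = matrix (\<lambda>x. THE y. y \<in> span B \<and> (\<forall>z\<in>span B. orthogonal (x - y) z))"

definition omega :: "('n::{finite,linorder} \<Rightarrow> 'n) \<Rightarrow> 'n set \<Rightarrow> 'n \<Rightarrow> real" where
  "omega pa S j =
     norm (column j (path_matrix pa) v*
           (mat 1 - proj_matrix ((\<lambda>k. column k (path_matrix pa)) ` insert tree_root S)))
     / sqrt (real CARD('n))"

definition weight :: "('n::{finite,linorder} \<Rightarrow> 'n) \<Rightarrow> 'n set \<Rightarrow> real \<Rightarrow> 'n \<Rightarrow> real" where
  "weight pa S \<gamma> j = 1 - omega pa S j / \<gamma>"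

text \<open>
  The squared weighted compatibility constant.  It is extended-real valued because the constraint
  cannot be met when \<open>S\<close> is empty: the minimum over the empty set is then \<open>\<infinity>\<close>.
\<close>

definition kappa_sq :: "('n::{finite,linorder} \<Rightarrow> 'n) \<Rightarrow> 'n set \<Rightarrow> real \<Rightarrow> ereal" where
  "kappa_sq pa S \<gamma> =
     (INF \<beta> \<in> {\<beta>::real^('n::{finite,linorder}). (\<Sum>j\<in>S. \<bar>weight pa S \<gamma> j * \<beta> $ j\<bar>)
                 - (\<Sum>j\<in>- insert tree_root S. \<bar>weight pa S \<gamma> j * \<beta> $ j\<bar>) = 1}.
        ereal ((real (card S) + 1) * sqnorm_n (path_matrix pa *v \<beta>)))"

definition tv_estimator :: "('n::{finite,linorder} \<Rightarrow> 'n) \<Rightarrow> real \<Rightarrow> real^('n::{finite,linorder}) \<Rightarrow> real^('n::{finite,linorder})" where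
  "tv_estimator pa lam y =
     arg_min (\<lambda>f. sqnorm_n (y - f) + 2 * lam * (\<Sum>i\<in>- {tree_root}. \<bar>edge_diff pa f i\<bar>)) (\<lambda>_. True)"

end

theory Submission
  imports Defs
begin

text \<open>
  The estimator minimises a strongly convex objective, so it beats every competitor \<open>f\<close> not only in
  the objective but by the additional term \<open>\<parallel>h\<parallel>\<^sub>n\<^sup>2\<close>, where \<open>h\<close> is the difference between the estimator
  and \<open>f\<close> (\<open>tv_basic_inequality\<close>).  It remains to bound the noise term \<open>2 \<epsilon> \<bullet> h / n\<close> and the
  difference of the penalties.

  In path coordinates \<open>h = X \<beta>\<close> the entries of \<open>\<beta>\<close> at the edges are the edge differences of \<open>h\<close>.
  Projecting the noise onto the columns of the root and of \<open>S\<close> splits \<open>\<epsilon> \<bullet> h\<close> into \<open>\<Pi>\<epsilon> \<bullet> h\<close> and a sum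
  over the edges outside \<open>S\<close>, with coefficients \<open>\<epsilon> \<bullet> (I - \<Pi>) X\<^sub>j\<close> (\<open>noise_decomposition\<close>).  These
  coefficients are Gaussian with standard deviation \<open>\<sigma> \<surd>n \<omega>\<^sub>j\<close>, and \<open>lam\<close> is chosen so that all of them
  are at most \<open>n lam \<omega>\<^sub>j / \<gamma>\<close> in absolute value with probability at least \<open>1 - \<delta>/2\<close>.  The penalty then
  absorbs them.  Apart from the contribution of the edge differences of \<open>f\<close> outside \<open>S\<close>, what remains of the
  penalty has exactly the weights \<open>1 - \<omega>\<^sub>j / \<gamma>\<close> of the compatibility constant, which bounds it by a
  multiple of \<open>\<parallel>h\<parallel>\<^sub>n\<close> (\<open>kappa_sq_compatibility\<close>).
  The term \<open>\<Pi>\<epsilon> \<bullet> h\<close> is at most \<open>\<parallel>\<Pi>\<epsilon>\<parallel> \<parallel>h\<parallel>\<close>, where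
  \<open>\<parallel>\<Pi>\<epsilon>\<parallel>\<^sup>2 / \<sigma>\<^sup>2\<close> is chi-squared with at most \<open>s + 1\<close> degrees of freedom; its tail beyond
  \<open>2 (s + 1) + 4 ln (2 / \<delta>)\<close> has probability at most \<open>\<delta>/2\<close> (\<open>projection_tail\<close>).  Splitting both
  products by the inequality of arithmetic and geometric means uses up \<open>\<parallel>h\<parallel>\<^sub>n\<^sup>2\<close> and leaves the stated
  constants (\<open>oracle_inequality_deterministic\<close>).

  The good event depends neither on \<open>f\<close> nor on the estimator, so the infimum over \<open>f\<close> can be
  taken pointwise on it.
\<close>

section \<open>Penalised least squares with a convex penalty\<close>

text \<open>
  A convex penalty leaves the strong convexity of \<open>h \<mapsto> \<parallel>y - h\<parallel>\<^sup>2\<close> intact, so a minimiser beats any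
  competitor by their squared distance.  This extra term pays for the cross terms in the oracle
  inequality and gives the stability of the minimiser in \<open>y\<close>.
\<close>

lemma penalized_least_squares_gap:
  fixes y f g :: "'a::real_inner"
  assumes conv: "convex_on UNIV P"
    and min: "\<And>h. (norm (y - f))\<^sup>2 + P f \<le> (norm (y - h))\<^sup>2 + P h"
  shows "(norm (y - f))\<^sup>2 + P f + (norm (f - g))\<^sup>2 \<le> (norm (y - g))\<^sup>2 + P g"
proof -
  let ?F = "(norm (y - f))\<^sup>2 + P f" and ?G = "(norm (y - g))\<^sup>2 + P g" and ?d = "(norm (f - g))\<^sup>2"
  have "(1 - t) * ?d \<le> ?G - ?F" if t: "0 < t" "t < 1" for t
  proof -
    let ?h = "(1 - t) *\<^sub>R f + t *\<^sub>R g"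
    have "P ?h \<le> (1 - t) * P f + t * P g"
      using conv t unfolding convex_on_def by simp
    moreover have "(norm (y - ?h))\<^sup>2
        = (1 - t) * (norm (y - f))\<^sup>2 + t * (norm (y - g))\<^sup>2 - t * (1 - t) * ?d"
      unfolding power2_norm_eq_inner
      by (simp add: inner_diff_left inner_diff_right inner_add_left inner_add_right
          inner_commute algebra_simps)
    ultimately have "?F \<le> (1 - t) * ?F + t * ?G - t * (1 - t) * ?d"
      using min[of ?h] by (simp add: algebra_simps)
    then have "t * ((1 - t) * ?d) \<le> t * (?G - ?F)"
      by (simp add: algebra_simps)
    then show ?thesis using t by (simp only: mult_le_cancel_left_pos)
  qed
  \<comment> \<open>Moving towards \<open>g\<close> by the fraction \<open>t\<close> loses the factor \<open>1 - t\<close>, which disappears for \<open>t \<rightarrow> 0\<close>.\<close>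
  then have "eventually (\<lambda>t. (1 - t) * ?d \<le> ?G - ?F) (at_right 0)"
    by (auto simp: eventually_at_right_field intro!: exI[of _ 1])
  moreover have "((\<lambda>t. (1 - t) * ?d) \<longlongrightarrow> (1 - 0) * ?d) (at_right 0)"
    by (intro tendsto_intros)
  ultimately have "(1 - 0) * ?d \<le> ?G - ?F"
    by (intro tendsto_upperbound) auto
  then show ?thesis by simp
qed

lemma penalized_least_squares_ex:
  fixes y :: "'a::euclidean_space"
  assumes cont: "continuous_on UNIV P" and nonneg: "\<And>f. 0 \<le> P f"
  shows "\<exists>f. \<forall>g. (norm (y - f))\<^sup>2 + P f \<le> (norm (y - g))\<^sup>2 + P g"
proof -
  let ?G = "\<lambda>f. (norm (y - f))\<^sup>2 + P f"
  \<comment> \<open>Outside this ball the data term alone is at least \<open>P y\<close>, the objective at \<open>y\<close>.\<close>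
  define r where "r = sqrt (P y)"
  have "continuous_on (cball y r) ?G"
    by (intro continuous_intros continuous_on_subset[OF cont]) auto
  moreover have y: "y \<in> cball y r" by (simp add: r_def nonneg)
  ultimately obtain f where f: "\<And>g. g \<in> cball y r \<Longrightarrow> ?G f \<le> ?G g"
    using continuous_attains_inf[OF compact_cball, of y r ?G] by blast
  have "?G f \<le> ?G g" for g
  proof (cases "g \<in> cball y r")
    case False
    then have "r\<^sup>2 \<le> (norm (y - g))\<^sup>2"
      by (intro power_mono) (auto simp: dist_norm r_def nonneg)
    moreover have "r\<^sup>2 = ?G y" by (simp add: r_def nonneg)
    moreover have "?G f \<le> ?G y" by (rule f[OF y])
    ultimately show ?thesis using nonneg[of g] by linarith
  qed (rule f)
  then show ?thesis by blast
qed

text \<open>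
  Adding the gap inequalities of the two problems, each tested at the other's minimiser, cancels the
  penalties; what remains is compared by Cauchy-Schwarz.
\<close>

lemma penalized_least_squares_nonexpansive:
  fixes y z f g :: "'a::real_inner"
  assumes conv: "convex_on UNIV P"
    and f: "\<And>h. (norm (y - f))\<^sup>2 + P f \<le> (norm (y - h))\<^sup>2 + P h"
    and g: "\<And>h. (norm (z - g))\<^sup>2 + P g \<le> (norm (z - h))\<^sup>2 + P h"
  shows "norm (f - g) \<le> norm (y - z)"
proof -
  have "2 * (norm (f - g))\<^sup>2 \<le> 2 * ((y - z) \<bullet> (f - g))"
    using penalized_least_squares_gap[OF conv f, of g] penalized_least_squares_gap[OF conv g, of f]
    unfolding power2_norm_eq_inner by (simp add: inner_simps inner_commute)
  also have "\<dots> \<le> 2 * (norm (y - z) * norm (f - g))"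
    using norm_cauchy_schwarz by simp
  finally show ?thesis
    by (cases "norm (f - g) = 0") (auto simp: power2_eq_square)
qed

section \<open>The total variation estimator\<close>

lemma sqnorm_n_eq: "sqnorm_n (v :: real^'n) = (norm v)\<^sup>2 / real CARD('n)"
  by (simp add: sqnorm_n_def norm_vec_def L2_set_def sum_nonneg)

text \<open>
  The objective of the estimator is multiplied by \<open>n\<close>, so that its data term is a Euclidean norm.
\<close>

definition tv_penalty ::
  "('n::{finite,linorder} \<Rightarrow> 'n) \<Rightarrow> real \<Rightarrow> real^('n::{finite,linorder}) \<Rightarrow> real" where
  "tv_penalty pa lam f = real CARD('n) * (2 * lam * (\<Sum>i\<in>- {tree_root}. \<bar>edge_diff pa f i\<bar>))"

lemma tv_penalty_nonneg: "0 \<le> lam \<Longrightarrow> 0 \<le> tv_penalty pa lam f"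
  by (simp add: tv_penalty_def sum_nonneg)

lemma continuous_on_tv_penalty: "continuous_on UNIV (tv_penalty pa lam)"
  unfolding tv_penalty_def[abs_def] edge_diff_def by (intro continuous_intros)

lemma convex_on_tv_penalty:
  assumes "0 \<le> lam"
  shows "convex_on UNIV (tv_penalty pa lam)"
proof -
  have "(\<Sum>i\<in>- {tree_root}. \<bar>edge_diff pa (u *\<^sub>R f + v *\<^sub>R g) i\<bar>)
      \<le> u * (\<Sum>i\<in>- {tree_root}. \<bar>edge_diff pa f i\<bar>) + v * (\<Sum>i\<in>- {tree_root}. \<bar>edge_diff pa g i\<bar>)"
    if "0 \<le> u" "0 \<le> v" for u v f g
  proof -
    have "\<bar>edge_diff pa (u *\<^sub>R f + v *\<^sub>R g) i\<bar> \<le> u * \<bar>edge_diff pa f i\<bar> + v * \<bar>edge_diff pa g i\<bar>" for i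
      using abs_triangle_ineq[of "u * edge_diff pa f i" "v * edge_diff pa g i"] that
      by (simp add: edge_diff_def inner_add_right abs_mult)
    then show ?thesis
      by (simp add: sum_distrib_left sum.distrib[symmetric] sum_mono)
  qed
  then have "convex_on UNIV (\<lambda>f. \<Sum>i\<in>- {tree_root}. \<bar>edge_diff pa f i\<bar>)"
    by (simp add: convex_on_def)
  then show ?thesis
    unfolding tv_penalty_def[abs_def] using assms by (intro convex_on_cmul) auto
qed

lemma tv_estimator_minimises:
  fixes pa :: "'n::{finite,linorder} \<Rightarrow> 'n"
  assumes "0 \<le> lam"
  shows "(norm (y - tv_estimator pa lam y))\<^sup>2 + tv_penalty pa lam (tv_estimator pa lam y)
    \<le> (norm (y - g))\<^sup>2 + tv_penalty pa lam g"
proof -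
  let ?G = "\<lambda>f. sqnorm_n (y - f) + 2 * lam * (\<Sum>i\<in>- {tree_root}. \<bar>edge_diff pa f i\<bar>)"
  have G: "(norm (y - f))\<^sup>2 + tv_penalty pa lam f = real CARD('n) * ?G f" for f
    by (simp add: sqnorm_n_eq tv_penalty_def distrib_left)
  obtain f where f: "\<And>g. (norm (y - f))\<^sup>2 + tv_penalty pa lam f \<le> (norm (y - g))\<^sup>2 + tv_penalty pa lam g"
    using penalized_least_squares_ex[OF continuous_on_tv_penalty tv_penalty_nonneg[OF assms], of y pa]
    by blast
  then have le: "?G f \<le> ?G g" for g by (simp add: G)
  have "\<forall>g. \<not> ?G g < ?G (tv_estimator pa lam y)"
    unfolding tv_estimator_def
    by (rule arg_minI[of "\<lambda>_. True" f ?G "\<lambda>x. \<forall>g. \<not> ?G g < ?G x"])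
      (use le in \<open>auto simp: not_less\<close>)
  then show ?thesis by (simp add: G not_less)
qed

text \<open>
  Continuity makes the estimator Borel measurable, hence the event of the oracle inequality an
  event of the probability space.
\<close>

lemma continuous_tv_estimator:
  assumes "0 \<le> lam"
  shows "continuous_on UNIV (tv_estimator pa lam)"
  unfolding continuous_on_iff dist_norm
proof (intro ballI allI impI)
  fix y and e :: real assume "0 < e"
  have *: "norm (tv_estimator pa lam z - tv_estimator pa lam y) \<le> norm (z - y)" for z
    by (rule penalized_least_squares_nonexpansive[OF convex_on_tv_penalty])
      (rule assms tv_estimator_minimises)+
  show "\<exists>d>0. \<forall>z\<in>UNIV. norm (z - y) < d \<longrightarrow> norm (tv_estimator pa lam z - tv_estimator pa lam y) < e"
    using le_less_trans[OF *] \<open>0 < e\<close> by (intro exI[of _ e] conjI ballI impI)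
qed

text \<open>
  The gap inequality for the estimator, after the squares \<open>\<parallel>Y - \<cdot>\<parallel>\<^sup>2\<close> have been expanded around \<open>f0\<close>.
\<close>

lemma tv_basic_inequality:
  fixes pa :: "'n::{finite,linorder} \<Rightarrow> 'n" and f0 e f :: "real^('n::{finite,linorder})"
  assumes "0 \<le> lam"
  defines "fh \<equiv> tv_estimator pa lam (f0 + e)"
  shows "sqnorm_n (fh - f0) + sqnorm_n (fh - f)
    \<le> sqnorm_n (f - f0) + 2 * (e \<bullet> (fh - f)) / real CARD('n)
      + 2 * lam * ((\<Sum>i\<in>- {tree_root}. \<bar>edge_diff pa f i\<bar>) - (\<Sum>i\<in>- {tree_root}. \<bar>edge_diff pa fh i\<bar>))"
proof -
  let ?n = "real CARD('n)"
  have "(norm (f0 + e - fh))\<^sup>2 + tv_penalty pa lam fh + (norm (fh - f))\<^sup>2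
      \<le> (norm (f0 + e - f))\<^sup>2 + tv_penalty pa lam f"
    unfolding fh_def
    by (intro penalized_least_squares_gap convex_on_tv_penalty tv_estimator_minimises assms)
  moreover have "(norm (f0 + e - f))\<^sup>2 - (norm (f0 + e - fh))\<^sup>2
      = (norm (f - f0))\<^sup>2 - (norm (fh - f0))\<^sup>2 + 2 * (e \<bullet> (fh - f))"
    unfolding power2_norm_eq_inner by (simp add: inner_simps inner_commute)
  ultimately have *: "(norm (fh - f0))\<^sup>2 + (norm (fh - f))\<^sup>2
      \<le> (norm (f - f0))\<^sup>2 + 2 * (e \<bullet> (fh - f)) + tv_penalty pa lam f - tv_penalty pa lam fh"
    by linarith
  have "((norm (fh - f0))\<^sup>2 + (norm (fh - f))\<^sup>2) / ?n
      \<le> ((norm (f - f0))\<^sup>2 + 2 * (e \<bullet> (fh - f)) + tv_penalty pa lam f - tv_penalty pa lam fh) / ?n"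
    using * by (rule divide_right_mono) simp
  then show ?thesis
    unfolding sqnorm_n_eq tv_penalty_def
    by (simp add: add_divide_distrib diff_divide_distrib right_diff_distrib mult.assoc)
qed

section \<open>Orthogonal projections\<close>

text \<open>
  The expansion in an orthonormal basis \<open>B\<close> of the span lies in the span and leaves a residual
  orthogonal to \<open>B\<close>; orthogonality makes such a point unique, so it is the one selected by the
  definition of the projection.
\<close>

lemma
  fixes A B :: "(real^'n) set"
  assumes fin: "finite B" and orth: "pairwise orthogonal B" and norm1: "\<forall>b\<in>B. norm b = 1"
    and span: "span B = span A"
  shows proj_matrix_orthonormal: "proj_matrix A *v x = (\<Sum>b\<in>B. (b \<bullet> x) *\<^sub>R b)"
    and proj_matrix_orthonormal_residual: "z \<in> span A \<Longrightarrow> orthogonal (x - proj_matrix A *v x) z"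
proof -
  let ?p = "\<lambda>x. \<Sum>b\<in>B. (b \<bullet> x) *\<^sub>R b"
  have in_span: "?p x \<in> span A" for x
    unfolding span[symmetric] by (rule span_sum) (simp add: span_base span_scale)
  have residual: "orthogonal (x - ?p x) z" if "z \<in> span A" for x z
  proof -
    have "orthogonal (x - ?p x) c" if c: "c \<in> B" for c
    proof -
      have "(b \<bullet> x) *\<^sub>R b \<bullet> c = (if b = c then c \<bullet> x else 0)" if "b \<in> B" for b
      proof (cases "b = c")
        case True
        then show ?thesis using norm1 c by (simp add: dot_square_norm)
      next
        case False
        then have "b \<bullet> c = 0" using orth c that by (simp add: pairwise_def orthogonal_def)
        then show ?thesis using False by simp
      qed
      then have "?p x \<bullet> c = c \<bullet> x"
        using c fin by (simp add: inner_sum_left)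
      then show ?thesis
        by (simp add: orthogonal_def inner_diff_left inner_commute[of x])
    qed
    then show ?thesis
      by (intro orthogonal_to_span[of z B "x - ?p x"]) (use that span in auto)
  qed
  have "(THE y. y \<in> span A \<and> (\<forall>z\<in>span A. orthogonal (x - y) z)) = ?p x" for x
  proof (rule the_equality)
    fix y assume y: "y \<in> span A \<and> (\<forall>z\<in>span A. orthogonal (x - y) z)"
    then have d: "y - ?p x \<in> span A" using in_span by (simp add: span_diff)
    have "(y - ?p x) \<bullet> (y - ?p x) = (x - ?p x) \<bullet> (y - ?p x) - (x - y) \<bullet> (y - ?p x)"
      by (simp add: inner_diff_left)
    also have "\<dots> = 0"
      using y residual d by (simp add: orthogonal_def)
    finally show "y = ?p x" by simp
  qed (use in_span residual in blast)
  then have "proj_matrix A = matrix ?p"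
    by (simp add: proj_matrix_def)
  moreover have "linear ?p"
    by (intro linearI)
      (simp_all add: inner_add_right scaleR_add_left sum.distrib scaleR_sum_right)
  ultimately have eq: "proj_matrix A *v x = ?p x" by simp
  then show "proj_matrix A *v x = ?p x" .
  show "orthogonal (x - proj_matrix A *v x) z" if "z \<in> span A"
    unfolding eq using that by (rule residual)
qed

lemma orthonormal_basis_of_span:
  fixes A :: "(real^'n) set"
  assumes "finite A"
  obtains B where "finite B" "pairwise orthogonal B" "\<forall>b\<in>B. norm b = 1"
    "card B \<le> card A" "span B = span A"
proof -
  obtain B where B: "pairwise orthogonal B" "\<forall>b\<in>B. norm b = 1"
      "independent B" "card B = dim (span A)" "span B = span A"
    using orthonormal_basis_subspace[OF subspace_span[of A]] by metis
  moreover have "dim (span A) \<le> card A"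
    using assms by (simp add: dim_le_card')
  ultimately show ?thesis
    using that independent_imp_finite by metis
qed

lemma
  fixes A :: "(real^'n) set"
  assumes "finite A"
  shows proj_matrix_in_span: "proj_matrix A *v x \<in> span A"
    and proj_matrix_residual: "z \<in> span A \<Longrightarrow> (x - proj_matrix A *v x) \<bullet> z = 0"
proof -
  obtain B where B: "finite B" "pairwise orthogonal B" "\<forall>b\<in>B. norm b = 1" and span: "span B = span A"
    using orthonormal_basis_of_span[OF assms] by metis
  show "proj_matrix A *v x \<in> span A"
    unfolding proj_matrix_orthonormal[OF B span]
    unfolding span[symmetric] by (rule span_sum) (simp add: span_base span_scale)
  show "(x - proj_matrix A *v x) \<bullet> z = 0" if "z \<in> span A"
    using proj_matrix_orthonormal_residual[OF B span that] by (simp add: orthogonal_def)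
qed

lemma proj_matrix_self_adjoint:
  fixes A :: "(real^'n) set"
  assumes "finite A"
  shows "(proj_matrix A *v x) \<bullet> y = x \<bullet> (proj_matrix A *v y)"
  using proj_matrix_residual[OF assms proj_matrix_in_span[OF assms], of x y]
    proj_matrix_residual[OF assms proj_matrix_in_span[OF assms], of y x]
  by (simp add: inner_diff_left inner_diff_right inner_commute)

lemma proj_matrix_fixes_span:
  fixes A :: "(real^'n) set"
  assumes "finite A" "x \<in> span A"
  shows "proj_matrix A *v x = x"
proof -
  have "x - proj_matrix A *v x \<in> span A"
    using assms by (intro span_diff proj_matrix_in_span)
  then have "(x - proj_matrix A *v x) \<bullet> (x - proj_matrix A *v x) = 0"
    using assms(1) by (rule proj_matrix_residual[rotated])
  then show ?thesis by simp
qed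

lemma norm_proj_matrix_residual_le:
  fixes A :: "(real^'n) set"
  assumes "finite A"
  shows "norm (x - proj_matrix A *v x) \<le> norm x"
proof -
  let ?p = "proj_matrix A *v x"
  have "(norm x)\<^sup>2 = (norm (x - ?p))\<^sup>2 + (norm ?p)\<^sup>2 + 2 * ((x - ?p) \<bullet> ?p)"
    unfolding power2_norm_eq_inner by (simp add: inner_simps inner_commute)
  also have "(x - ?p) \<bullet> ?p = 0"
    using assms by (intro proj_matrix_residual proj_matrix_in_span)
  finally have "(norm (x - ?p))\<^sup>2 \<le> (norm x)\<^sup>2" by simp
  then show ?thesis by (rule power2_le_imp_le) simp
qed

section \<open>Path coordinates\<close>

definition path_columns ::
  "('n::{finite,linorder} \<Rightarrow> 'n) \<Rightarrow> 'n set \<Rightarrow> (real^('n::{finite,linorder})) set" where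
  "path_columns pa T = (\<lambda>k. column k (path_matrix pa)) ` T"

text \<open>
  The vector \<open>(I - \<Pi>) X\<^sub>j\<close>, whose length is \<open>\<surd>n \<omega>\<^sub>j\<close>.
\<close>

definition path_residual ::
  "('n::{finite,linorder} \<Rightarrow> 'n) \<Rightarrow> 'n set \<Rightarrow> 'n \<Rightarrow> real^('n::{finite,linorder})" where
  "path_residual pa S j = column j (path_matrix pa)
     - proj_matrix (path_columns pa (insert tree_root S)) *v column j (path_matrix pa)"

lemma finite_path_columns: "finite (path_columns pa T)"
  by (simp add: path_columns_def)

lemma path_matrix_inverse:
  fixes pa :: "'n::{finite,linorder} \<Rightarrow> 'n"
  assumes "parent_function pa"
  shows "path_matrix pa ** rooted_incidence pa = mat 1"
proof -
  have "path_matrix pa = (\<chi> i j. of_bool ((i, j) \<in> (to_root pa)\<^sup>*))"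
    by (simp add: vec_eq_iff path_matrix_nth[OF assms])
  then show ?thesis
    using rooted_incidence_path[OF assms] matrix_left_right_inverse by metis
qed

lemma rooted_incidence_nth:
  "i \<noteq> tree_root \<Longrightarrow> (rooted_incidence pa *v h) $ i = edge_diff pa h i"
  by (simp add: matrix_vector_mul_component rooted_incidence_def edge_diff_def)

lemma path_expansion:
  fixes pa :: "'n::{finite,linorder} \<Rightarrow> 'n"
  assumes "parent_function pa"
  shows "path_matrix pa *v (rooted_incidence pa *v h) = h"
  by (simp add: matrix_vector_mul_assoc path_matrix_inverse[OF assms])

text \<open>
  The projection is self-adjoint, so multiplying the row vector \<open>X\<^sub>j'\<close> by \<open>I - \<Pi>\<close> from the right
  gives the residual of \<open>X\<^sub>j\<close>.
\<close>

lemma omega_eq: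
  fixes pa :: "'n::{finite,linorder} \<Rightarrow> 'n"
  shows "omega pa S j = norm (path_residual pa S j) / sqrt (real CARD('n))"
proof -
  let ?P = "proj_matrix (path_columns pa (insert tree_root S))" and ?x = "column j (path_matrix pa)"
  have "(?x v* (mat 1 - ?P)) \<bullet> y = (?x - ?P *v ?x) \<bullet> y" for y
    using proj_matrix_self_adjoint[OF finite_path_columns, of pa "insert tree_root S" ?x y]
    by (simp add: dot_lmul_matrix matrix_vector_mult_diff_rdistrib inner_diff_left inner_diff_right)
  then have "?x v* (mat 1 - ?P) = ?x - ?P *v ?x"
    by (metis vector_eq_rdot)
  then show ?thesis by (simp add: omega_def path_residual_def path_columns_def)
qed

text \<open>
  The entries of \<open>X\<^sub>j\<close> are 0 or 1, so \<open>\<parallel>X\<^sub>j\<parallel> \<le> \<surd>n\<close>, and projecting does not lengthen it.  Hence all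
  weights are nonnegative as soon as \<open>\<gamma> \<ge> 1\<close>.
\<close>

lemma omega_le_1:
  assumes "parent_function pa"
  shows "omega pa S j \<le> 1"
proof -
  have "(norm (column j (path_matrix pa)))\<^sup>2 \<le> real CARD('a)"
  proof -
    have "(norm (column j (path_matrix pa)))\<^sup>2 = (\<Sum>i\<in>UNIV. (of_bool ((i, j) \<in> (to_root pa)\<^sup>*))\<^sup>2)"
      by (simp add: norm_vec_def L2_set_def column_def path_matrix_nth[OF assms] sum_nonneg)
    also have "\<dots> \<le> (\<Sum>i\<in>(UNIV :: 'a set). 1)"
      by (intro sum_mono) simp
    finally show ?thesis by simp
  qed
  then have "norm (column j (path_matrix pa)) \<le> sqrt (real CARD('a))"
    by (simp add: real_le_rsqrt)
  then have "norm (path_residual pa S j) \<le> sqrt (real CARD('a))"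
    unfolding path_residual_def
    using norm_proj_matrix_residual_le[OF finite_path_columns] order_trans by metis
  then show ?thesis by (simp add: omega_eq)
qed

lemma path_residual_anchor:
  assumes "j \<in> insert tree_root S"
  shows "path_residual pa S j = 0"
proof -
  have "column j (path_matrix pa) \<in> span (path_columns pa (insert tree_root S))"
    using assms by (intro span_base) (auto simp: path_columns_def)
  then show ?thesis
    by (simp add: path_residual_def proj_matrix_fixes_span finite_path_columns)
qed

text \<open>
  In path coordinates \<open>h = X \<beta>\<close>, where \<open>\<beta>\<close> consists of the root value of \<open>h\<close> and its edge differences.
  The columns of the root and of \<open>S\<close> are invisible to \<open>I - \<Pi>\<close>, so the part of the noise orthogonal
  to them meets only the edges outside \<open>S\<close>, which the penalty controls.
\<close>

lemma noise_decomposition: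
  fixes pa :: "'n::{finite,linorder} \<Rightarrow> 'n" and e h :: "real^('n::{finite,linorder})"
  assumes tree: "parent_function pa"
  shows "e \<bullet> h = (proj_matrix (path_columns pa (insert tree_root S)) *v e) \<bullet> h
      + (\<Sum>j\<in>- insert tree_root S. edge_diff pa h j * (e \<bullet> path_residual pa S j))"
proof -
  let ?P = "proj_matrix (path_columns pa (insert tree_root S))"
  define \<beta> where "\<beta> = rooted_incidence pa *v h"
  have h: "h = (\<Sum>j\<in>UNIV. \<beta> $ j *\<^sub>R column j (path_matrix pa))"
    using path_expansion[OF tree, of h]
    by (simp add: \<beta>_def matrix_mult_sum scalar_mult_eq_scaleR)
  have "h - ?P *v h = (\<Sum>j\<in>UNIV. \<beta> $ j *\<^sub>R path_residual pa S j)"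
    unfolding path_residual_def
    by (subst (1 2) h)
      (simp add: linear_sum matrix_vector_mult_scaleR scaleR_diff_right sum_subtractf)
  also have "\<dots> = (\<Sum>j\<in>- insert tree_root S. \<beta> $ j *\<^sub>R path_residual pa S j)"
    by (rule sum.mono_neutral_right) (use path_residual_anchor in auto)
  also have "\<dots> = (\<Sum>j\<in>- insert tree_root S. edge_diff pa h j *\<^sub>R path_residual pa S j)"
    by (rule sum.cong) (auto simp: \<beta>_def rooted_incidence_nth)
  finally have "e \<bullet> (h - ?P *v h)
      = (\<Sum>j\<in>- insert tree_root S. edge_diff pa h j * (e \<bullet> path_residual pa S j))"
    by (simp add: inner_sum_right)
  moreover have "e \<bullet> (?P *v h) = (?P *v e) \<bullet> h"
    by (simp add: proj_matrix_self_adjoint finite_path_columns)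
  ultimately show ?thesis by (simp add: inner_diff_right)
qed

section \<open>The weighted compatibility constant\<close>

text \<open>
  The path matrix is invertible, so \<open>\<beta>\<close>, and with it the constraint functional, is bounded by a
  multiple of \<open>\<parallel>X \<beta>\<parallel>\<close>.  Therefore the bound of the theorem is finite.
\<close>

lemma kappa_sq_pos:
  fixes pa :: "'n::{finite,linorder} \<Rightarrow> 'n"
  assumes tree: "parent_function pa"
  shows "0 < kappa_sq pa S \<gamma>"
proof -
  let ?D = "rooted_incidence pa" and ?X = "path_matrix pa" and ?s = "real (card S) + 1"
  define C where "C = (\<Sum>j\<in>S. \<bar>weight pa S \<gamma> j\<bar> * norm (?D $ j))"
  \<comment> \<open>The summand 1 keeps the denominator positive when \<open>C = 0\<close>.\<close>
  define c where "c = ?s / ((C\<^sup>2 + 1) * real CARD('n))"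
  have C: "0 < C\<^sup>2 + 1" by (simp add: add_nonneg_pos)
  then have "0 < c" by (simp add: c_def)
  have "c \<le> ?s * sqnorm_n (?X *v \<beta>)"
    if \<beta>: "(\<Sum>j\<in>S. \<bar>weight pa S \<gamma> j * \<beta> $ j\<bar>)
              - (\<Sum>j\<in>- insert tree_root S. \<bar>weight pa S \<gamma> j * \<beta> $ j\<bar>) = 1" for \<beta>
  proof -
    have "?D ** ?X = mat 1"
      using path_matrix_inverse[OF tree] matrix_left_right_inverse by metis
    then have "\<beta> = ?D *v (?X *v \<beta>)"
      by (simp add: matrix_vector_mul_assoc)
    then have nth: "\<beta> $ j = ?D $ j \<bullet> (?X *v \<beta>)" for j
      by (metis matrix_vector_mul_component)
    have "\<bar>weight pa S \<gamma> j * \<beta> $ j\<bar> \<le> \<bar>weight pa S \<gamma> j\<bar> * norm (?D $ j) * norm (?X *v \<beta>)" for j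
      unfolding abs_mult nth mult.assoc by (intro mult_left_mono Cauchy_Schwarz_ineq2) simp
    then have "(\<Sum>j\<in>S. \<bar>weight pa S \<gamma> j * \<beta> $ j\<bar>) \<le> C * norm (?X *v \<beta>)"
      unfolding C_def sum_distrib_right by (rule sum_mono)
    moreover have "0 \<le> (\<Sum>j\<in>- insert tree_root S. \<bar>weight pa S \<gamma> j * \<beta> $ j\<bar>)"
      by (rule sum_nonneg) simp
    ultimately have "1 \<le> C * norm (?X *v \<beta>)" using \<beta> by linarith
    then have "1 \<le> (C * norm (?X *v \<beta>))\<^sup>2" by (simp add: one_le_power)
    then have "1 \<le> (C\<^sup>2 + 1) * (norm (?X *v \<beta>))\<^sup>2"
      by (simp add: power_mult_distrib distrib_right add_increasing2)
    then have "1 / (C\<^sup>2 + 1) \<le> (norm (?X *v \<beta>))\<^sup>2"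
      using C by (simp add: pos_divide_le_eq mult.commute)
    then have "?s * (1 / (C\<^sup>2 + 1)) / real CARD('n) \<le> ?s * (norm (?X *v \<beta>))\<^sup>2 / real CARD('n)"
      by (intro divide_right_mono mult_left_mono) auto
    then show ?thesis by (simp add: c_def sqnorm_n_eq)
  qed
  then have "ereal c \<le> kappa_sq pa S \<gamma>"
    unfolding kappa_sq_def by (intro INF_greatest) simp
  moreover have "0 < ereal c" using \<open>0 < c\<close> by simp
  ultimately show ?thesis by (rule less_le_trans[rotated])
qed

text \<open>
  The real number \<open>K = \<surd>(s + 1) / \<kappa>\<close> turns the infimum, taken over a normalised constraint, into an
  inequality for all \<open>\<beta>\<close>, both sides being positively homogeneous of degree 1.  For an infeasible
  constraint \<open>\<kappa> = \<infinity>\<close> and \<open>K = 0\<close>.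
\<close>

lemma kappa_sq_compatibility:
  fixes pa :: "'n::{finite,linorder} \<Rightarrow> 'n"
  assumes tree: "parent_function pa"
  obtains K where "ereal (K\<^sup>2) = ereal (real (card S) + 1) / kappa_sq pa S \<gamma>"
    and "\<And>\<beta>. (\<Sum>j\<in>S. \<bar>weight pa S \<gamma> j * \<beta> $ j\<bar>)
              - (\<Sum>j\<in>- insert tree_root S. \<bar>weight pa S \<gamma> j * \<beta> $ j\<bar>)
            \<le> K * sqrt (sqnorm_n (path_matrix pa *v \<beta>))"
proof -
  define \<Delta> where "\<Delta> \<beta> = (\<Sum>j\<in>S. \<bar>weight pa S \<gamma> j * \<beta> $ j\<bar>)
              - (\<Sum>j\<in>- insert tree_root S. \<bar>weight pa S \<gamma> j * \<beta> $ j\<bar>)" for \<beta>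
  define Q where "Q \<beta> = sqnorm_n (path_matrix pa *v \<beta>)" for \<beta>
  let ?s = "real (card S) + 1"
  have Q0: "0 \<le> Q \<beta>" for \<beta> by (simp add: Q_def sqnorm_n_eq)
  have kappa: "kappa_sq pa S \<gamma> = (INF \<beta>\<in>{\<beta>. \<Delta> \<beta> = 1}. ereal (?s * Q \<beta>))"
    by (simp add: kappa_sq_def \<Delta>_def Q_def)
  have pos: "0 < kappa_sq pa S \<gamma>" by (rule kappa_sq_pos[OF tree])
  have scaled: "kappa_sq pa S \<gamma> \<le> ereal (?s * (Q \<beta> / (\<Delta> \<beta>)\<^sup>2))" if d: "0 < \<Delta> \<beta>" for \<beta>
  proof -
    have "\<Delta> ((1 / \<Delta> \<beta>) *\<^sub>R \<beta>) = \<Delta> \<beta> / \<Delta> \<beta>"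
      using d unfolding \<Delta>_def[of "_ *\<^sub>R _"] \<Delta>_def[of \<beta>, symmetric]
      by (simp add: abs_mult diff_divide_distrib[symmetric] sum_divide_distrib[symmetric])
         (simp add: \<Delta>_def abs_mult)
    then have "kappa_sq pa S \<gamma> \<le> ereal (?s * Q ((1 / \<Delta> \<beta>) *\<^sub>R \<beta>))"
      unfolding kappa using d by (intro INF_lower) simp
    also have "Q ((1 / \<Delta> \<beta>) *\<^sub>R \<beta>) = Q \<beta> / (\<Delta> \<beta>)\<^sup>2"
      by (simp add: Q_def sqnorm_n_eq matrix_vector_mult_scaleR power_divide)
    finally show ?thesis .
  qed
  show thesis
  proof (cases "kappa_sq pa S \<gamma>")
    case (real k)
    then have k: "0 < k" using pos by simp
    have "\<Delta> \<beta> \<le> sqrt (?s / k) * sqrt (Q \<beta>)" for \<beta>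
    proof (cases "0 < \<Delta> \<beta>")
      case True
      then have "(\<Delta> \<beta>)\<^sup>2 \<le> ?s / k * Q \<beta>"
        using scaled[OF True] real k by (simp add: field_simps)
      then show ?thesis by (simp add: real_le_rsqrt flip: real_sqrt_mult)
    next
      case False
      moreover have "0 \<le> sqrt (?s / k) * sqrt (Q \<beta>)" using k Q0 by simp
      ultimately show ?thesis by linarith
    qed
    then show thesis
      using that[of "sqrt (?s / k)"] real k by (simp add: \<Delta>_def Q_def)
  next
    case PInf
    have "\<Delta> \<beta> \<le> 0 * sqrt (Q \<beta>)" for \<beta>
      using scaled[of \<beta>] PInf by (cases "0 < \<Delta> \<beta>") auto
    then show thesis
      using that[of 0] PInf by (simp add: \<Delta>_def Q_def)
  next
    case MInf
    then show thesis using pos by simp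
  qed
qed

section \<open>The oracle inequality for a fixed noise vector\<close>

text \<open>
  Here \<open>h\<close> is the difference between the estimator and the competitor \<open>f\<close>.  The noise on the edges
  outside \<open>S\<close> costs at most the fraction \<open>\<omega>\<^sub>j / \<gamma>\<close> of the penalty that \<open>h\<close> pays there, which leaves the
  weights \<open>w\<^sub>j\<close> and so the functional bounded by the compatibility constant.  The projected noise and the
  compatibility term each contribute a product with \<open>\<parallel>h\<parallel>\<^sub>n\<close>; each product is split so that it spends half
  of the term \<open>\<parallel>h\<parallel>\<^sub>n\<^sup>2\<close> provided by the gap inequality.
\<close>

lemma oracle_inequality_deterministic:
  fixes pa :: "'n::{finite,linorder} \<Rightarrow> 'n" and f0 e f :: "real^('n::{finite,linorder})"
  assumes tree: "parent_function pa" and S: "S \<subseteq> - {tree_root}" and lam: "0 \<le> lam" and \<gamma>: "1 < \<gamma>"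
    and noise: "\<And>j. j \<notin> insert tree_root S \<Longrightarrow>
      \<bar>e \<bullet> path_residual pa S j\<bar> \<le> real CARD('n) * lam * omega pa S j / \<gamma>"
    and compat: "\<And>\<beta>. (\<Sum>j\<in>S. \<bar>weight pa S \<gamma> j * \<beta> $ j\<bar>)
              - (\<Sum>j\<in>- insert tree_root S. \<bar>weight pa S \<gamma> j * \<beta> $ j\<bar>)
            \<le> K * sqrt (sqnorm_n (path_matrix pa *v \<beta>))"
  shows "sqnorm_n (tv_estimator pa lam (f0 + e) - f0)
    \<le> sqnorm_n (f - f0) + 4 * lam * (\<Sum>i\<in>- {tree_root} - S. \<bar>edge_diff pa f i\<bar>)
      + 2 * sqnorm_n (proj_matrix (path_columns pa (insert tree_root S)) *v e) + 2 * lam\<^sup>2 * K\<^sup>2"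
proof -
  let ?n = "real CARD('n)" and ?T = "- insert tree_root S"
  define fh where "fh = tv_estimator pa lam (f0 + e)"
  define h where "h = fh - f"
  define Pe where "Pe = proj_matrix (path_columns pa (insert tree_root S)) *v e"
  define q where "q = sqrt (sqnorm_n h)"
  let ?b = "\<lambda>j. edge_diff pa h j"
  have n: "0 < ?n" by simp
  have split: "(\<Sum>i\<in>- {tree_root}. g i) = (\<Sum>i\<in>S. g i) + (\<Sum>i\<in>?T. g i)" for g :: "'n \<Rightarrow> real"
  proof -
    have "- {tree_root} = S \<union> ?T" using S by auto
    moreover have "S \<inter> ?T = {}" by auto
    ultimately show ?thesis by (metis finite sum.union_disjoint)
  qed
  have q2: "q\<^sup>2 = sqnorm_n h" by (simp add: q_def sqnorm_n_eq)
  have proj_part: "2 * (Pe \<bullet> h) / ?n \<le> 2 * sqnorm_n Pe + q\<^sup>2 / 2"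
  proof -
    have "0 \<le> (norm (2 *\<^sub>R Pe - h))\<^sup>2" by simp
    also have "\<dots> = 4 * (norm Pe)\<^sup>2 + (norm h)\<^sup>2 - 4 * (Pe \<bullet> h)"
      unfolding power2_norm_eq_inner by (simp add: inner_simps inner_commute)
    finally have "2 * (Pe \<bullet> h) \<le> 2 * (norm Pe)\<^sup>2 + (norm h)\<^sup>2 / 2" by simp
    then have "2 * (Pe \<bullet> h) / ?n \<le> (2 * (norm Pe)\<^sup>2 + (norm h)\<^sup>2 / 2) / ?n"
      by (rule divide_right_mono) simp
    then show ?thesis by (simp add: q2 sqnorm_n_eq add_divide_distrib)
  qed
  have noise_part: "2 * (\<Sum>j\<in>?T. ?b j * (e \<bullet> path_residual pa S j)) / ?n
      \<le> 2 * lam * (\<Sum>j\<in>?T. omega pa S j / \<gamma> * \<bar>?b j\<bar>)"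
  proof -
    have "?b j * (e \<bullet> path_residual pa S j) \<le> ?n * lam * (omega pa S j / \<gamma> * \<bar>?b j\<bar>)"
      if "j \<in> ?T" for j
    proof -
      have "?b j * (e \<bullet> path_residual pa S j) \<le> \<bar>?b j\<bar> * \<bar>e \<bullet> path_residual pa S j\<bar>"
        by (metis abs_ge_self abs_mult)
      also have "\<dots> \<le> \<bar>?b j\<bar> * (?n * lam * omega pa S j / \<gamma>)"
        using noise[of j] that by (intro mult_left_mono) auto
      finally show ?thesis by (simp add: ac_simps)
    qed
    then have "(\<Sum>j\<in>?T. ?b j * (e \<bullet> path_residual pa S j))
        \<le> ?n * lam * (\<Sum>j\<in>?T. omega pa S j / \<gamma> * \<bar>?b j\<bar>)"
      unfolding sum_distrib_left by (rule sum_mono)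
    then show ?thesis using n by (simp add: field_simps)
  qed
  \<comment> \<open>On \<open>S\<close> the penalties differ by at most \<open>\<bar>Dh\<bar>\<close>; off \<open>S\<close> the estimator pays \<open>\<bar>Dh\<bar> - \<bar>Df\<bar>\<close> at least.\<close>
  have penalty_part: "(\<Sum>i\<in>- {tree_root}. \<bar>edge_diff pa f i\<bar>) - (\<Sum>i\<in>- {tree_root}. \<bar>edge_diff pa fh i\<bar>)
      \<le> (\<Sum>j\<in>S. \<bar>?b j\<bar>) + 2 * (\<Sum>j\<in>?T. \<bar>edge_diff pa f j\<bar>) - (\<Sum>j\<in>?T. \<bar>?b j\<bar>)"
  proof -
    have fh: "edge_diff pa fh j = edge_diff pa f j + ?b j" for j
      by (simp add: h_def edge_diff_def inner_diff_right)
    have "(\<Sum>j\<in>S. \<bar>edge_diff pa f j\<bar>) \<le> (\<Sum>j\<in>S. \<bar>edge_diff pa fh j\<bar> + \<bar>?b j\<bar>)"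
      by (intro sum_mono) (simp add: fh)
    moreover have "(\<Sum>j\<in>?T. \<bar>?b j\<bar>) \<le> (\<Sum>j\<in>?T. \<bar>edge_diff pa fh j\<bar> + \<bar>edge_diff pa f j\<bar>)"
      by (intro sum_mono) (simp add: fh)
    ultimately show ?thesis
      unfolding split by (simp add: sum.distrib)
  qed
  have compat_part: "(\<Sum>j\<in>S. \<bar>?b j\<bar>) - (\<Sum>j\<in>?T. (1 - omega pa S j / \<gamma>) * \<bar>?b j\<bar>) \<le> K * q"
  proof -
    define \<beta> where "\<beta> = rooted_incidence pa *v h"
    have coord: "\<beta> $ j = ?b j" if "j \<in> S \<or> j \<in> ?T" for j
    proof -
      have "j \<noteq> tree_root" using that S by auto
      then show ?thesis by (simp add: \<beta>_def rooted_incidence_nth)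
    qed
    have "omega pa S j = 0" if "j \<in> S" for j
      using path_residual_anchor[of j S] that by (simp add: omega_eq)
    then have "(\<Sum>j\<in>S. \<bar>weight pa S \<gamma> j * \<beta> $ j\<bar>) = (\<Sum>j\<in>S. \<bar>?b j\<bar>)"
      by (intro sum.cong) (auto simp: weight_def coord)
    moreover have "0 \<le> weight pa S \<gamma> j" for j
      using omega_le_1[OF tree, of S j] \<gamma> by (simp add: weight_def)
    then have "(\<Sum>j\<in>?T. \<bar>weight pa S \<gamma> j * \<beta> $ j\<bar>) = (\<Sum>j\<in>?T. (1 - omega pa S j / \<gamma>) * \<bar>?b j\<bar>)"
      by (intro sum.cong) (auto simp: abs_mult coord weight_def)
    ultimately show ?thesis
      using compat[of \<beta>] by (simp add: \<beta>_def path_expansion[OF tree] q_def)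
  qed
  have "2 * lam * (K * q) \<le> 2 * lam\<^sup>2 * K\<^sup>2 + q\<^sup>2 / 2"
  proof -
    have "0 \<le> (2 * lam * K - q)\<^sup>2" by simp
    then show ?thesis by (simp add: power2_eq_square algebra_simps)
  qed
  moreover have "2 * lam * ((\<Sum>j\<in>S. \<bar>?b j\<bar>) - (\<Sum>j\<in>?T. (1 - omega pa S j / \<gamma>) * \<bar>?b j\<bar>)) \<le> 2 * lam * (K * q)"
    using compat_part lam by (intro mult_left_mono) auto
  moreover have "2 * lam * ((\<Sum>i\<in>- {tree_root}. \<bar>edge_diff pa f i\<bar>) - (\<Sum>i\<in>- {tree_root}. \<bar>edge_diff pa fh i\<bar>))
      \<le> 2 * lam * ((\<Sum>j\<in>S. \<bar>?b j\<bar>) + 2 * (\<Sum>j\<in>?T. \<bar>edge_diff pa f j\<bar>) - (\<Sum>j\<in>?T. \<bar>?b j\<bar>))"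
    using penalty_part lam by (intro mult_left_mono) auto
  moreover have "sqnorm_n (fh - f0) + q\<^sup>2
    \<le> sqnorm_n (f - f0) + 2 * (e \<bullet> h) / ?n
      + 2 * lam * ((\<Sum>i\<in>- {tree_root}. \<bar>edge_diff pa f i\<bar>) - (\<Sum>i\<in>- {tree_root}. \<bar>edge_diff pa fh i\<bar>))"
    using tv_basic_inequality[OF lam, of pa f0 e f] by (simp add: fh_def h_def q2)
  moreover have "2 * (e \<bullet> h) / ?n
      = 2 * (Pe \<bullet> h) / ?n + 2 * (\<Sum>j\<in>?T. ?b j * (e \<bullet> path_residual pa S j)) / ?n"
    unfolding noise_decomposition[OF tree, of e h S] Pe_def by (simp add: add_divide_distrib)
  moreover have "- {tree_root} - S = ?T" by auto
  moreover have "(\<Sum>j\<in>?T. (1 - omega pa S j / \<gamma>) * \<bar>?b j\<bar>)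
      = (\<Sum>j\<in>?T. \<bar>?b j\<bar>) - (\<Sum>j\<in>?T. omega pa S j / \<gamma> * \<bar>?b j\<bar>)"
    by (simp add: left_diff_distrib sum_subtractf)
  ultimately show ?thesis
    using proj_part noise_part unfolding fh_def[symmetric] Pe_def[symmetric]
    by (simp add: right_diff_distrib distrib_left)
qed

section \<open>Gaussian noise\<close>

lemma nn_integral_normal_density:
  assumes "0 < \<sigma>"
  shows "(\<integral>\<^sup>+x. ennreal (normal_density \<mu> \<sigma> x) \<partial>lborel) = 1"
  using assms by (simp add: nn_integral_eq_integral)

text \<open>
  Completing the square turns the integrand into \<open>exp (\<sigma>\<^sup>2 c\<^sup>2 / 2)\<close> times a shifted normal density.
\<close>

lemma normal_exponential_moment:
  assumes \<sigma>: "0 < \<sigma>"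
  shows "(\<integral>\<^sup>+x. ennreal (normal_density 0 \<sigma> x) * ennreal (exp (c * x)) \<partial>lborel)
    = ennreal (exp (\<sigma>\<^sup>2 * c\<^sup>2 / 2))"
proof -
  have "normal_density 0 \<sigma> x * exp (c * x) = exp (\<sigma>\<^sup>2 * c\<^sup>2 / 2) * normal_density (\<sigma>\<^sup>2 * c) \<sigma> x" for x
  proof -
    have "- x\<^sup>2 / (2 * \<sigma>\<^sup>2) + c * x = \<sigma>\<^sup>2 * c\<^sup>2 / 2 + - (x - \<sigma>\<^sup>2 * c)\<^sup>2 / (2 * \<sigma>\<^sup>2)"
      using \<sigma> by (simp add: field_simps power2_eq_square)
    then have "exp (- x\<^sup>2 / (2 * \<sigma>\<^sup>2)) * exp (c * x)
        = exp (\<sigma>\<^sup>2 * c\<^sup>2 / 2) * exp (- (x - \<sigma>\<^sup>2 * c)\<^sup>2 / (2 * \<sigma>\<^sup>2))"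
      by (simp only: exp_add[symmetric])
    then show ?thesis by (simp add: normal_density_def)
  qed
  then have "(\<integral>\<^sup>+x. ennreal (normal_density 0 \<sigma> x) * ennreal (exp (c * x)) \<partial>lborel)
     = (\<integral>\<^sup>+x. ennreal (exp (\<sigma>\<^sup>2 * c\<^sup>2 / 2)) * ennreal (normal_density (\<sigma>\<^sup>2 * c) \<sigma> x) \<partial>lborel)"
    by (simp flip: ennreal_mult)
  also have "\<dots> = ennreal (exp (\<sigma>\<^sup>2 * c\<^sup>2 / 2))"
    using \<sigma> by (simp add: nn_integral_cmult nn_integral_normal_density)
  finally show ?thesis .
qed

text \<open>
  The factor \<open>exp (x\<^sup>2 / 4)\<close> doubles the variance of the normal density and spoils its
  normalisation by \<open>\<surd>2\<close>.
\<close>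

lemma std_normal_exponential_square_moment:
  "(\<integral>\<^sup>+x. ennreal (std_normal_density x) * ennreal (exp (x\<^sup>2 / 4)) \<partial>lborel) = ennreal (sqrt 2)"
proof -
  have "std_normal_density x * exp (x\<^sup>2 / 4) = sqrt 2 * normal_density 0 (sqrt 2) x" for x
  proof -
    have "exp (- x\<^sup>2 / 2) * exp (x\<^sup>2 / 4) = exp (- x\<^sup>2 / 4)"
      by (simp add: exp_add[symmetric])
    moreover have "sqrt (2 * pi * (sqrt 2)\<^sup>2) = sqrt 2 * sqrt (2 * pi)"
      by (simp add: real_sqrt_mult[symmetric])
    ultimately show ?thesis
      by (simp add: normal_density_def)
  qed
  then have "(\<integral>\<^sup>+x. ennreal (std_normal_density x) * ennreal (exp (x\<^sup>2 / 4)) \<partial>lborel)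
     = (\<integral>\<^sup>+x. ennreal (sqrt 2) * ennreal (normal_density 0 (sqrt 2) x) \<partial>lborel)"
    by (simp flip: ennreal_mult)
  also have "\<dots> = ennreal (sqrt 2)"
    by (simp add: nn_integral_cmult nn_integral_normal_density)
  finally show ?thesis .
qed

lemma (in prob_space) exponential_Markov:
  assumes X: "X \<in> borel_measurable M" and m: "0 \<le> m"
    and moment: "(\<integral>\<^sup>+x. ennreal (exp (X x)) \<partial>M) \<le> ennreal m"
  shows "prob {x \<in> space M. a \<le> X x} \<le> m * exp (- a)"
proof -
  have "{x \<in> space M. a \<le> X x} = {x \<in> space M. 1 \<le> ennreal (exp (- a)) * ennreal (exp (X x))}"
    by (auto simp flip: ennreal_mult exp_add ennreal_1)
  also have "emeasure M \<dots> \<le> ennreal (exp (- a)) * (\<integral>\<^sup>+x. ennreal (exp (X x)) * indicator (space M) x \<partial>M)"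
    using X by (intro nn_integral_Markov_inequality) auto
  also have "(\<integral>\<^sup>+x. ennreal (exp (X x)) * indicator (space M) x \<partial>M) = (\<integral>\<^sup>+x. ennreal (exp (X x)) \<partial>M)"
    by (rule nn_integral_cong) simp
  also have "ennreal (exp (- a)) * \<dots> \<le> ennreal (exp (- a)) * ennreal m"
    using moment by (rule mult_left_mono) simp
  also have "\<dots> = ennreal (m * exp (- a))"
    using m by (simp add: mult.commute flip: ennreal_mult)
  finally show ?thesis
    using m by (simp add: emeasure_eq_measure)
qed

locale gaussian_noise = prob_space M for M :: "'a measure" +
  fixes \<epsilon> :: "'a \<Rightarrow> real^'n" and \<sigma> :: real
  assumes \<sigma>_pos: "0 < \<sigma>"
    and indep_coords: "indep_vars (\<lambda>_. borel) (\<lambda>i \<omega>. \<epsilon> \<omega> $ i) UNIV"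
    and normal_coords: "\<And>i. distributed M lborel (\<lambda>\<omega>. \<epsilon> \<omega> $ i) (normal_density 0 \<sigma>)"
begin

lemma measurable_noise[measurable]: "\<epsilon> \<in> borel_measurable M"
proof -
  have "(\<lambda>\<omega>. \<epsilon> \<omega> $ i) \<in> borel_measurable M" for i
    using indep_coords by (simp add: indep_vars_def)
  then show ?thesis
    by (intro borel_measurable_euclidean_space[THEN iffD2]) (auto simp: Basis_vec_def inner_axis)
qed

lemma exponential_moment_linear:
  "(\<integral>\<^sup>+\<omega>. ennreal (exp (v \<bullet> \<epsilon> \<omega>)) \<partial>M) = ennreal (exp (\<sigma>\<^sup>2 * (norm v)\<^sup>2 / 2))"
proof -
  have "(\<integral>\<^sup>+\<omega>. ennreal (exp (v \<bullet> \<epsilon> \<omega>)) \<partial>M) = (\<integral>\<^sup>+\<omega>. (\<Prod>i\<in>UNIV. ennreal (exp (v $ i * \<epsilon> \<omega> $ i))) \<partial>M)"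
    by (simp add: inner_vec_def exp_sum prod_ennreal)
  also have "\<dots> = (\<Prod>i\<in>UNIV. \<integral>\<^sup>+\<omega>. ennreal (exp (v $ i * \<epsilon> \<omega> $ i)) \<partial>M)"
    by (intro indep_vars_nn_integral indep_vars_compose2[OF indep_coords]) auto
  also have "\<dots> = (\<Prod>i\<in>UNIV. ennreal (exp (\<sigma>\<^sup>2 * (v $ i)\<^sup>2 / 2)))"
  proof (rule prod.cong)
    fix i
    have "(\<integral>\<^sup>+\<omega>. ennreal (exp (v $ i * \<epsilon> \<omega> $ i)) \<partial>M)
        = (\<integral>\<^sup>+x. ennreal (normal_density 0 \<sigma> x) * ennreal (exp (v $ i * x)) \<partial>lborel)"
      by (rule distributed_nn_integral[OF normal_coords, symmetric]) simp
    then show "(\<integral>\<^sup>+\<omega>. ennreal (exp (v $ i * \<epsilon> \<omega> $ i)) \<partial>M) = ennreal (exp (\<sigma>\<^sup>2 * (v $ i)\<^sup>2 / 2))"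
      by (simp add: normal_exponential_moment[OF \<sigma>_pos])
  qed simp
  also have "\<dots> = ennreal (exp (\<Sum>i\<in>UNIV. \<sigma>\<^sup>2 * (v $ i)\<^sup>2 / 2))"
    by (simp add: exp_sum prod_ennreal)
  also have "(\<Sum>i\<in>UNIV. \<sigma>\<^sup>2 * (v $ i)\<^sup>2 / 2) = \<sigma>\<^sup>2 * (norm v)\<^sup>2 / 2"
    by (simp add: norm_vec_def L2_set_def sum_nonneg sum_distrib_left sum_divide_distrib)
  finally show ?thesis .
qed

text \<open>
  Chernoff's bound for \<open>v \<bullet> \<epsilon>\<close> and \<open>- v \<bullet> \<epsilon>\<close>.  The degenerate direction \<open>v = 0\<close> is covered because the
  inequality in the event is strict.
\<close>

lemma linear_tail:
  assumes \<tau>: "0 \<le> \<tau>"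
  shows "prob {\<omega> \<in> space M. \<sigma> * norm v * \<tau> < \<bar>v \<bullet> \<epsilon> \<omega>\<bar>} \<le> 2 * exp (- \<tau>\<^sup>2 / 2)"
proof (cases "v = 0")
  case False
  \<comment> \<open>This multiple of \<open>v\<close> minimises the Chernoff bound.\<close>
  define \<theta> where "\<theta> = \<tau> / (\<sigma> * norm v)"
  have pos: "0 < \<sigma> * norm v" using False \<sigma>_pos by simp
  have one_sided: "prob {\<omega> \<in> space M. \<tau>\<^sup>2 \<le> u \<bullet> \<epsilon> \<omega>} \<le> exp (- \<tau>\<^sup>2 / 2)" if u: "\<sigma>\<^sup>2 * (norm u)\<^sup>2 = \<tau>\<^sup>2" for u
  proof -
    have "prob {\<omega> \<in> space M. \<tau>\<^sup>2 \<le> u \<bullet> \<epsilon> \<omega>} \<le> exp (\<tau>\<^sup>2 / 2) * exp (- \<tau>\<^sup>2)"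
      by (rule exponential_Markov) (simp_all add: exponential_moment_linear u)
    also have "\<dots> = exp (- \<tau>\<^sup>2 / 2)" by (simp flip: exp_add)
    finally show ?thesis .
  qed
  have norm_u: "\<sigma>\<^sup>2 * (norm (\<theta> *\<^sub>R v))\<^sup>2 = \<tau>\<^sup>2"
    using False \<sigma>_pos by (simp add: \<theta>_def power_mult_distrib power_divide)
  have "{\<omega> \<in> space M. \<sigma> * norm v * \<tau> < \<bar>v \<bullet> \<epsilon> \<omega>\<bar>}
      \<subseteq> {\<omega> \<in> space M. \<tau>\<^sup>2 \<le> (\<theta> *\<^sub>R v) \<bullet> \<epsilon> \<omega>} \<union> {\<omega> \<in> space M. \<tau>\<^sup>2 \<le> (- \<theta> *\<^sub>R v) \<bullet> \<epsilon> \<omega>}"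
  proof
    fix \<omega> assume \<omega>: "\<omega> \<in> {\<omega> \<in> space M. \<sigma> * norm v * \<tau> < \<bar>v \<bullet> \<epsilon> \<omega>\<bar>}"
    then have "\<theta> * (\<sigma> * norm v * \<tau>) \<le> \<theta> * \<bar>v \<bullet> \<epsilon> \<omega>\<bar>"
      using pos \<tau> by (intro mult_left_mono) (auto simp: \<theta>_def)
    also have "\<theta> * (\<sigma> * norm v * \<tau>) = \<tau>\<^sup>2"
      using False \<sigma>_pos by (simp add: \<theta>_def power2_eq_square)
    finally show "\<omega> \<in> {\<omega> \<in> space M. \<tau>\<^sup>2 \<le> (\<theta> *\<^sub>R v) \<bullet> \<epsilon> \<omega>} \<union> {\<omega> \<in> space M. \<tau>\<^sup>2 \<le> (- \<theta> *\<^sub>R v) \<bullet> \<epsilon> \<omega>}"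
      using \<omega> by (cases "0 \<le> v \<bullet> \<epsilon> \<omega>") auto
  qed
  then have "prob {\<omega> \<in> space M. \<sigma> * norm v * \<tau> < \<bar>v \<bullet> \<epsilon> \<omega>\<bar>}
      \<le> prob ({\<omega> \<in> space M. \<tau>\<^sup>2 \<le> (\<theta> *\<^sub>R v) \<bullet> \<epsilon> \<omega>} \<union> {\<omega> \<in> space M. \<tau>\<^sup>2 \<le> (- \<theta> *\<^sub>R v) \<bullet> \<epsilon> \<omega>})"
    by (rule finite_measure_mono) measurable
  also have "\<dots> \<le> prob {\<omega> \<in> space M. \<tau>\<^sup>2 \<le> (\<theta> *\<^sub>R v) \<bullet> \<epsilon> \<omega>} + prob {\<omega> \<in> space M. \<tau>\<^sup>2 \<le> (- \<theta> *\<^sub>R v) \<bullet> \<epsilon> \<omega>}"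
    by (rule measure_Un_le) measurable
  also have "\<dots> \<le> 2 * exp (- \<tau>\<^sup>2 / 2)"
    using one_sided[OF norm_u] one_sided[of "- \<theta> *\<^sub>R v"] norm_u by simp
  finally show ?thesis .
qed simp

text \<open>
  Up to scaling the quadratic form is chi-squared with \<open>card B\<close> degrees of freedom.  Each factor
  \<open>exp (z\<^sup>2 / (4 \<sigma>\<^sup>2))\<close> is itself an exponential moment \<open>E exp (c g z)\<close> of an auxiliary standard normal
  \<open>g\<close>, which linearises the exponent in \<open>\<epsilon>\<close> and so reduces the claim to linear forms of \<open>\<epsilon>\<close>.  After exchanging the integrals, the moment over \<open>\<epsilon>\<close> depends only on
  \<open>\<parallel>\<Sum>\<^sub>b c g\<^sub>b b\<parallel>\<^sup>2 = c\<^sup>2 \<Sum>\<^sub>b g\<^sub>b\<^sup>2\<close>, by orthonormality, and the integral over the \<open>g\<^sub>b\<close> factorises.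
\<close>

lemma exponential_moment_quadratic:
  assumes B: "finite B" "pairwise orthogonal B" "\<forall>b\<in>B. norm b = 1"
  shows "(\<integral>\<^sup>+\<omega>. ennreal (exp ((\<Sum>b\<in>B. (b \<bullet> \<epsilon> \<omega>)\<^sup>2) / (4 * \<sigma>\<^sup>2))) \<partial>M) = ennreal (sqrt 2 ^ card B)"
proof -
  define N where "N = density lborel (\<lambda>x. ennreal (std_normal_density x))"
  \<comment> \<open>With this value \<open>E exp (c g z) = exp (c\<^sup>2 z\<^sup>2 / 2)\<close> is the required factor.\<close>
  define c where "c = 1 / (sqrt 2 * \<sigma>)"
  have c2: "c\<^sup>2 = 1 / (2 * \<sigma>\<^sup>2)" by (simp add: c_def power_divide power_mult_distrib)
  interpret N: prob_space N
    unfolding N_def by (rule prob_space_normal_density) simp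
  have [measurable_cong]: "sets N = sets borel" by (simp add: N_def)
  interpret prod: product_prob_space "\<lambda>_. N" B by standard
  interpret finite_prod: finite_product_prob_space "\<lambda>_. N" B by standard (rule B)
  let ?G = "Pi\<^sub>M B (\<lambda>_. N)"
  interpret pair: pair_sigma_finite M ?G by standard
  have inner_norm: "(norm (\<Sum>b\<in>B. (c * g b) *\<^sub>R b))\<^sup>2 = (\<Sum>b\<in>B. c\<^sup>2 * (g b)\<^sup>2)" for g
  proof -
    have "(norm (\<Sum>b\<in>B. (c * g b) *\<^sub>R b))\<^sup>2 = (\<Sum>b\<in>B. (norm ((c * g b) *\<^sub>R b))\<^sup>2)"
      using B by (intro norm_sum_Pythagorean) (auto simp: pairwise_def orthogonal_def)
    then show ?thesis using B by (simp add: power_mult_distrib)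
  qed
  have single: "(\<integral>\<^sup>+g. ennreal (exp (c * g * z)) \<partial>N) = ennreal (exp (z\<^sup>2 / (4 * \<sigma>\<^sup>2)))" for z
    unfolding N_def using normal_exponential_moment[of 1 "c * z"]
    by (simp add: nn_integral_density power_mult_distrib c2 mult.commute mult.left_commute mult.assoc)
  have square: "(\<integral>\<^sup>+g. ennreal (exp (\<sigma>\<^sup>2 * (c\<^sup>2 * g\<^sup>2) / 2)) \<partial>N) = ennreal (sqrt 2)"
    unfolding N_def using std_normal_exponential_square_moment \<sigma>_pos
    by (simp add: nn_integral_density c2)
  have "(\<integral>\<^sup>+\<omega>. ennreal (exp ((\<Sum>b\<in>B. (b \<bullet> \<epsilon> \<omega>)\<^sup>2) / (4 * \<sigma>\<^sup>2))) \<partial>M)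
      = (\<integral>\<^sup>+\<omega>. (\<Prod>b\<in>B. \<integral>\<^sup>+g. ennreal (exp (c * g * (b \<bullet> \<epsilon> \<omega>))) \<partial>N) \<partial>M)"
    by (simp add: single sum_divide_distrib exp_sum[OF B(1)] prod_ennreal)
  also have "\<dots> = (\<integral>\<^sup>+\<omega>. (\<integral>\<^sup>+g. (\<Prod>b\<in>B. ennreal (exp (c * g b * (b \<bullet> \<epsilon> \<omega>)))) \<partial>?G) \<partial>M)"
    by (subst prod.product_nn_integral_prod[OF B(1)]) auto
  also have "\<dots> = (\<integral>\<^sup>+\<omega>. (\<integral>\<^sup>+g. ennreal (exp ((\<Sum>b\<in>B. (c * g b) *\<^sub>R b) \<bullet> \<epsilon> \<omega>)) \<partial>?G) \<partial>M)"
    by (simp add: inner_sum_left exp_sum[OF B(1)] prod_ennreal)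
  also have "\<dots> = (\<integral>\<^sup>+g. (\<integral>\<^sup>+\<omega>. ennreal (exp ((\<Sum>b\<in>B. (c * g b) *\<^sub>R b) \<bullet> \<epsilon> \<omega>)) \<partial>M) \<partial>?G)"
    by (rule pair.Fubini'[symmetric]) (measurable)
  also have "\<dots> = (\<integral>\<^sup>+g. (\<Prod>b\<in>B. ennreal (exp (\<sigma>\<^sup>2 * (c\<^sup>2 * (g b)\<^sup>2) / 2))) \<partial>?G)"
    by (simp add: exponential_moment_linear inner_norm sum_distrib_left sum_divide_distrib
        exp_sum[OF B(1)] prod_ennreal)
  also have "\<dots> = (\<Prod>b\<in>B. \<integral>\<^sup>+g. ennreal (exp (\<sigma>\<^sup>2 * (c\<^sup>2 * g\<^sup>2) / 2)) \<partial>N)"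
    by (rule prod.product_nn_integral_prod[OF B(1)]) measurable
  also have "\<dots> = ennreal (sqrt 2 ^ card B)"
    by (simp add: square ennreal_power)
  finally show ?thesis .
qed

text \<open>
  Markov's inequality with the exponent \<open>1/4\<close> suffices for these constants, since \<open>\<surd>2 \<le> exp (1/2)\<close>.
\<close>

lemma quadratic_tail:
  assumes B: "finite B" "pairwise orthogonal B" "\<forall>b\<in>B. norm b = 1"
  shows "prob {\<omega> \<in> space M. 2 * \<sigma>\<^sup>2 * (real (card B) + 2 * t) \<le> (\<Sum>b\<in>B. (b \<bullet> \<epsilon> \<omega>)\<^sup>2)} \<le> exp (- t)"
proof -
  let ?k = "real (card B)"
  have "{\<omega> \<in> space M. 2 * \<sigma>\<^sup>2 * (?k + 2 * t) \<le> (\<Sum>b\<in>B. (b \<bullet> \<epsilon> \<omega>)\<^sup>2)}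
      = {\<omega> \<in> space M. ?k / 2 + t \<le> (\<Sum>b\<in>B. (b \<bullet> \<epsilon> \<omega>)\<^sup>2) / (4 * \<sigma>\<^sup>2)}"
    using \<sigma>_pos by (auto simp: field_simps)
  also have "prob \<dots> \<le> sqrt 2 ^ card B * exp (- (?k / 2 + t))"
    by (rule exponential_Markov) (simp_all add: exponential_moment_quadratic[OF B])
  also have "\<dots> \<le> exp (1 / 2) ^ card B * exp (- (?k / 2 + t))"
  proof (intro mult_right_mono power_mono)
    have "(sqrt 2)\<^sup>2 \<le> (exp (1 / 2))\<^sup>2"
      using exp_ge_add_one_self[of 1] by (simp flip: exp_double)
    then show "sqrt 2 \<le> exp (1 / 2)" by (rule power2_le_imp_le) simp
  qed auto
  also have "\<dots> = exp (- t)"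
    by (simp add: exp_of_nat_mult[symmetric] exp_add[symmetric])
  finally show ?thesis .
qed

end

text \<open>
  In an orthonormal basis of the span the squared length of the projected noise is the quadratic form
  of \<open>quadratic_tail\<close>, and the basis has at most \<open>card A\<close> elements.
\<close>

lemma (in gaussian_noise) projection_tail:
  fixes A :: "(real^'n) set"
  assumes A: "finite A"
  shows "prob {\<omega> \<in> space M. 2 * \<sigma>\<^sup>2 * (real (card A) + 2 * t) \<le> (norm (proj_matrix A *v \<epsilon> \<omega>))\<^sup>2} \<le> exp (- t)"
proof -
  obtain B where B: "finite B" "pairwise orthogonal B" "\<forall>b\<in>B. norm b = 1"
    and card: "card B \<le> card A" and span: "span B = span A"
    using orthonormal_basis_of_span[OF A] by metis
  have norm: "(norm (proj_matrix A *v e))\<^sup>2 = (\<Sum>b\<in>B. (b \<bullet> e)\<^sup>2)" for e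
  proof -
    have "(norm (proj_matrix A *v e))\<^sup>2 = e \<bullet> (proj_matrix A *v e)"
      using proj_matrix_residual[OF A proj_matrix_in_span[OF A], of e e]
      by (simp add: power2_norm_eq_inner inner_diff_left)
    also have "\<dots> = (\<Sum>b\<in>B. (b \<bullet> e)\<^sup>2)"
      unfolding proj_matrix_orthonormal[OF B span]
      by (simp add: inner_sum_right inner_commute power2_eq_square)
    finally show ?thesis .
  qed
  have "2 * \<sigma>\<^sup>2 * (real (card B) + 2 * t) \<le> 2 * \<sigma>\<^sup>2 * (real (card A) + 2 * t)"
    using card by (intro mult_left_mono) auto
  then have "prob {\<omega> \<in> space M. 2 * \<sigma>\<^sup>2 * (real (card A) + 2 * t) \<le> (norm (proj_matrix A *v \<epsilon> \<omega>))\<^sup>2}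
      \<le> prob {\<omega> \<in> space M. 2 * \<sigma>\<^sup>2 * (real (card B) + 2 * t) \<le> (\<Sum>b\<in>B. (b \<bullet> \<epsilon> \<omega>)\<^sup>2)}"
    unfolding norm by (intro finite_measure_mono) auto
  also have "\<dots> \<le> exp (- t)" by (rule quadratic_tail[OF B])
  finally show ?thesis .
qed

section \<open>The oracle inequality with high probability\<close>

theorem theorem2p5:
  fixes pa :: "'n::{finite,linorder} \<Rightarrow> 'n"
    and S :: "'n set"
    and M :: "'a measure"
    and \<epsilon> Y fhat :: "'a \<Rightarrow> real^('n::{finite,linorder})"
    and f0 :: "real^('n::{finite,linorder})"
    and \<sigma> \<delta> \<gamma> lam n s :: real
  assumes tree: "parent_function pa"
    and n: "n = real CARD('n)"
    and S: "S \<subseteq> - {tree_root}"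
    and s: "s = real (card S)"
    and M: "prob_space M"
    and \<sigma>: "0 < \<sigma>"
    and indep: "prob_space.indep_vars M (\<lambda>_. borel) (\<lambda>i \<omega>. \<epsilon> \<omega> $ i) UNIV"
    and normal: "\<And>i. distributed M lborel (\<lambda>\<omega>. \<epsilon> \<omega> $ i) (normal_density 0 \<sigma>)"
    and Y: "\<And>\<omega>. Y \<omega> = f0 + \<epsilon> \<omega>"
    and \<delta>: "0 < \<delta>" "\<delta> < 1"
    and \<gamma>: "1 < \<gamma>"
    and lam: "lam = \<gamma> * \<sigma> * sqrt (2 * ln (4 * (n - s - 1) / \<delta>) / n)"
    and fhat: "\<And>\<omega>. fhat \<omega> = tv_estimator pa lam (Y \<omega>)"
  shows "measure M {\<omega> \<in> space M.
           ereal (sqnorm_n (fhat \<omega> - f0))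
           \<le> ereal (INF f. sqnorm_n (f - f0)
                       + 4 * lam * (\<Sum>i\<in>- {tree_root} - S. \<bar>edge_diff pa f i\<bar>))
             + ereal (4 * \<sigma>\<^sup>2 / n)
               * (ereal (s + 1 + 2 * ln (2 / \<delta>))
                  + ereal (\<gamma>\<^sup>2 * (s + 1)) / kappa_sq pa S \<gamma> * ereal (ln (4 * (n - s - 1) / \<delta>)))}
         \<ge> 1 - \<delta>"
proof -
  interpret gaussian_noise M \<epsilon> \<sigma>
    using M \<sigma> indep normal by (simp add: gaussian_noise_def gaussian_noise_axioms_def)
  define T where "T = - insert tree_root S"
  define A where "A = path_columns pa (insert tree_root S)"
  define L where "L = ln (4 * (n - s - 1) / \<delta>)"
  define t where "t = ln (2 / \<delta>)"
  have card_T: "n - s - 1 = real (card T)"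
  proof -
    have "CARD('n) = card (insert tree_root S) + card T"
      unfolding T_def by (metis card_Un_disjoint finite Compl_disjoint Compl_partition)
    moreover have "card (insert tree_root S) = card S + 1" using S by (subst card_insert_disjoint) auto
    ultimately show ?thesis by (simp add: n s)
  qed
  have n_pos: "0 < n" by (simp add: n)
  have exp_L: "exp (- L) = \<delta> / (4 * real (card T))" if "T \<noteq> {}"
  proof -
    have "0 < card T" using that by (simp add: card_gt_0_iff)
    then show ?thesis using \<delta> by (simp add: L_def card_T exp_minus)
  qed
  \<comment> \<open>When \<open>S\<close> contains all edges, \<open>L = ln 0 = 0\<close>, so \<open>lam = 0\<close> and there is no noise event to exclude.\<close>
  have L_nonneg: "0 \<le> L"
  proof (cases "T = {}")
    case False
    then have "1 \<le> real (card T)" by (simp add: Suc_le_eq card_gt_0_iff)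
    then have "1 \<le> 4 * real (card T) / \<delta>" using \<delta> by (simp add: pos_le_divide_eq)
    then show ?thesis by (simp add: L_def card_T)
  qed (simp add: L_def card_T)
  have lam_eq: "lam = \<gamma> * \<sigma> * sqrt (2 * L / n)" by (simp add: lam L_def)
  have lam_nonneg: "0 \<le> lam" using \<gamma> \<sigma> L_nonneg n_pos by (simp add: lam_eq)
  have lam_sq: "lam\<^sup>2 = \<gamma>\<^sup>2 * \<sigma>\<^sup>2 * (2 * L / n)"
    using L_nonneg n_pos by (simp add: lam_eq power_mult_distrib)

  define bad_noise where "bad_noise j =
      {\<omega> \<in> space M. \<sigma> * norm (path_residual pa S j) * sqrt (2 * L) < \<bar>path_residual pa S j \<bullet> \<epsilon> \<omega>\<bar>}" for j
  define bad_proj where "bad_proj =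
      {\<omega> \<in> space M. 2 * \<sigma>\<^sup>2 * (real (card A) + 2 * t) \<le> (norm (proj_matrix A *v \<epsilon> \<omega>))\<^sup>2}"
  define bad where "bad = (\<Union>j\<in>T. bad_noise j) \<union> bad_proj"
  have meas_mult: "(\<lambda>x. proj_matrix A *v x) \<in> borel_measurable borel"
    by (intro borel_measurable_continuous_onI linear_continuous_on) simp
  have [measurable]: "bad_noise j \<in> sets M" for j
    unfolding bad_noise_def by measurable
  have [measurable]: "bad_proj \<in> sets M"
    unfolding bad_proj_def using measurable_compose[OF measurable_noise meas_mult] by measurable
  have bad_sets: "bad \<in> sets M" by (auto simp: bad_def)
  have "prob bad \<le> \<delta>"
  proof -
    have "prob (\<Union>j\<in>T. bad_noise j) \<le> (\<Sum>j\<in>T. prob (bad_noise j))"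
      by (rule finite_measure_subadditive_finite) auto
    also have "\<dots> \<le> (\<Sum>j\<in>T. 2 * exp (- L))"
    proof (rule sum_mono)
      fix j
      show "prob (bad_noise j) \<le> 2 * exp (- L)"
        using linear_tail[of "sqrt (2 * L)" "path_residual pa S j"] L_nonneg
        by (simp add: bad_noise_def)
    qed
    also have "\<dots> \<le> \<delta> / 2"
      using exp_L \<delta> by (cases "T = {}") (auto simp: card_gt_0_iff)
    finally have "prob (\<Union>j\<in>T. bad_noise j) \<le> \<delta> / 2" .
    moreover have "prob bad_proj \<le> \<delta> / 2"
      using projection_tail[of A t] \<delta>
      by (simp add: bad_proj_def A_def finite_path_columns t_def exp_minus)
    moreover have "prob bad \<le> prob (\<Union>j\<in>T. bad_noise j) + prob bad_proj"
      unfolding bad_def by (rule measure_Un_le) auto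
    ultimately show ?thesis by linarith
  qed

  obtain K where K: "ereal (K\<^sup>2) = ereal (real (card S) + 1) / kappa_sq pa S \<gamma>"
    and compat: "\<And>\<beta>. (\<Sum>j\<in>S. \<bar>weight pa S \<gamma> j * \<beta> $ j\<bar>)
              - (\<Sum>j\<in>- insert tree_root S. \<bar>weight pa S \<gamma> j * \<beta> $ j\<bar>)
            \<le> K * sqrt (sqnorm_n (path_matrix pa *v \<beta>))"
    by (rule kappa_sq_compatibility[OF tree, of S \<gamma>]) blast
  define F where "F f = sqnorm_n (f - f0) + 4 * lam * (\<Sum>i\<in>- {tree_root} - S. \<bar>edge_diff pa f i\<bar>)" for f
  define R where "R = 4 * \<sigma>\<^sup>2 / n * (s + 1 + 2 * t + \<gamma>\<^sup>2 * K\<^sup>2 * L)"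
  \<comment> \<open>All quantities are finite, so the extended-real bound is an ordinary real number.\<close>
  have bound_eq: "ereal (INF f. F f) + ereal (4 * \<sigma>\<^sup>2 / n) * (ereal (s + 1 + 2 * t)
        + ereal (\<gamma>\<^sup>2 * (s + 1)) / kappa_sq pa S \<gamma> * ereal L) = ereal ((INF f. F f) + R)"
  proof -
    have "ereal (\<gamma>\<^sup>2 * (s + 1)) / kappa_sq pa S \<gamma> = ereal (\<gamma>\<^sup>2) * (ereal (real (card S) + 1) / kappa_sq pa S \<gamma>)"
      unfolding divide_ereal_def s times_ereal.simps(1)[symmetric] mult.assoc ..
    then have "ereal (\<gamma>\<^sup>2 * (s + 1)) / kappa_sq pa S \<gamma> = ereal (\<gamma>\<^sup>2 * K\<^sup>2)"
      unfolding K[symmetric] by simp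
    then show ?thesis by (simp add: R_def)
  qed
  have good: "sqnorm_n (fhat \<omega> - f0) \<le> (INF f. F f) + R" if \<omega>: "\<omega> \<in> space M - bad" for \<omega>
  proof -
    have noise: "\<bar>\<epsilon> \<omega> \<bullet> path_residual pa S j\<bar> \<le> real CARD('n) * lam * omega pa S j / \<gamma>"
      if "j \<notin> insert tree_root S" for j
    proof -
      have "\<bar>\<epsilon> \<omega> \<bullet> path_residual pa S j\<bar> \<le> \<sigma> * norm (path_residual pa S j) * sqrt (2 * L)"
        using \<omega> that by (auto simp: bad_def bad_noise_def T_def inner_commute not_less)
      also have "\<dots> = n * lam * omega pa S j / \<gamma>"
      proof -
        have "n = sqrt n * sqrt n" using n_pos by simp
        then show ?thesis
          using \<gamma> n_pos by (simp add: lam_eq omega_eq real_sqrt_divide field_simps flip: n)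
      qed
      finally show ?thesis by (simp add: n)
    qed
    have "(norm (proj_matrix A *v \<epsilon> \<omega>))\<^sup>2 \<le> 2 * \<sigma>\<^sup>2 * (real (card A) + 2 * t)"
      using \<omega> by (auto simp: bad_def bad_proj_def)
    also have "\<dots> \<le> 2 * \<sigma>\<^sup>2 * (s + 1 + 2 * t)"
    proof -
      have "card A \<le> card (insert tree_root S)"
        unfolding A_def path_columns_def by (rule card_image_le) simp
      also have "\<dots> \<le> card S + 1" by (simp add: card_insert_if)
      finally have "real (card A) \<le> s + 1" by (simp add: s)
      then show ?thesis by (intro mult_left_mono) auto
    qed
    finally have "(norm (proj_matrix A *v \<epsilon> \<omega>))\<^sup>2 / n \<le> 2 * \<sigma>\<^sup>2 * (s + 1 + 2 * t) / n"
      using n_pos by (intro divide_right_mono) auto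
    then have "sqnorm_n (proj_matrix A *v \<epsilon> \<omega>) \<le> 2 * \<sigma>\<^sup>2 * (s + 1 + 2 * t) / n"
      by (simp add: sqnorm_n_eq n)
    moreover have "R = 2 * (2 * \<sigma>\<^sup>2 * (s + 1 + 2 * t) / n) + 2 * lam\<^sup>2 * K\<^sup>2"
      using n_pos by (simp add: R_def lam_sq field_simps)
    ultimately have proj: "2 * sqnorm_n (proj_matrix A *v \<epsilon> \<omega>) + 2 * lam\<^sup>2 * K\<^sup>2 \<le> R"
      by linarith
    have "sqnorm_n (fhat \<omega> - f0) - R \<le> F f" for f
      using oracle_inequality_deterministic[OF tree S lam_nonneg \<gamma> noise compat, of f0 f] proj
      by (simp add: fhat Y F_def A_def)
    then have "sqnorm_n (fhat \<omega> - f0) - R \<le> (INF f. F f)"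
      by (intro cINF_greatest) auto
    then show ?thesis by simp
  qed
  have fhat_measurable: "fhat \<in> borel_measurable M"
  proof -
    have "tv_estimator pa lam \<in> borel_measurable borel"
      by (rule borel_measurable_continuous_onI[OF continuous_tv_estimator[OF lam_nonneg]])
    moreover have "(\<lambda>\<omega>. f0 + \<epsilon> \<omega>) \<in> borel_measurable M" by measurable
    ultimately have "(\<lambda>\<omega>. tv_estimator pa lam (f0 + \<epsilon> \<omega>)) \<in> borel_measurable M"
      by (rule measurable_compose[rotated])
    then show ?thesis by (simp add: fhat[abs_def] Y)
  qed
  \<comment> \<open>Without measurability of the event its measure would be 0 by convention.\<close>
  have "1 - \<delta> \<le> 1 - prob bad" using \<open>prob bad \<le> \<delta>\<close> by simp
  also have "\<dots> = prob (space M - bad)" by (rule prob_compl[OF bad_sets, symmetric])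
  also have "\<dots> \<le> prob {\<omega> \<in> space M. sqnorm_n (fhat \<omega> - f0) \<le> (INF f. F f) + R}"
  proof (rule finite_measure_mono)
    show "{\<omega> \<in> space M. sqnorm_n (fhat \<omega> - f0) \<le> (INF f. F f) + R} \<in> sets M"
      unfolding sqnorm_n_eq using fhat_measurable by measurable
  qed (use good in auto)
  finally show ?thesis
    unfolding L_def[symmetric] t_def[symmetric] F_def[symmetric] bound_eq ereal_less_eq(3) by simp
qed

end
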